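(* Let $f(t)=\sum_{n=1}^{\infty}\frac{a_n}{\gamma_{n,\nu}}t^n$, $a_1\neq 0$, and $g(t)=\sum_{n=0}^{\infty}\frac{b_n}{\gamma_{n,\nu}}t^n$, $b_0\neq 0$, be formal power series. A sequence of polynomials $\{s_{n,\nu}(x)\}_{n=0}^{\infty}$ is the Sheffer-Dunkl sequence for $(g(t),f(t))$ if and only if there exists a function $\beta_\nu(x)$ of bounded variation on $(-\infty,\infty)$ such that: (i) there exist the moment integrals $$\omega_{n,\nu}=\int_{-\infty}^{\infty}x^n\,d\beta_\nu(x),\quad n=0,1,\ldots,$$ and $\omega_{0,\nu}\neq 0$; (ii) the polynomials $s_{n,\nu}(x)$ can be expressed as $$s_{n,\nu}(x)=\int_{-\infty}^{\infty}\tau_t(p_{n,\nu})(x)\,d\beta_\nu(t),$$ where $\{p_{n,\nu}(x)\}_{n=0}^{\infty}$ is the sequence of associated Dunkl polynomials for the function $f(t)$.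
   Context: Here $\nu>-1$ is a fixed parameter, and integrals $\int\cdot\,d\beta_\nu$ are Stieltjes integrals. The numbers $\gamma_{n,\nu}$ are defined by $\gamma_{2k,\nu}=2^{2k}k!\,(\nu+1)_k$ and $\gamma_{2k+1,\nu}=2^{2k+1}k!\,(\nu+1)_{k+1}$ for $k\ge 0$, where $(a)_n=a(a+1)\cdots(a+n-1)=\Gamma(a+n)/\Gamma(a)$ is the Pochhammer symbol. The Dunkl operator is $\Lambda_\nu p(x)=\frac{d}{dx}p(x)+\frac{2\nu+1}{2}\left(\frac{p(x)-p(-x)}{x}\right)$, with $\Lambda_\nu^0$ the identity operator and $\Lambda_\nu^{n+1}=\Lambda_\nu(\Lambda_\nu^n)$. The Dunkl translation is $\tau_y p(x)=\sum_{n=0}^\infty \Lambda_\nu^{n}p(x)\frac{y^n}{\gamma_{n,\nu}}$. For $f$ as in the claim, $\mathrm{L}_f$ is the linear operator on polynomials $\mathrm{L}_f p(x)=\sum_{n=1}^{\infty}\frac{a_n}{\gamma_{n,\nu}}\Lambda_\nu^n p(x)$, and $\overline f(t)$ denotes the compositional inverse of $f(t)$. The Dunkl exponential is $E_\nu(t)=\sum_{n=0}^\infty \frac{t^n}{\gamma_{n,\nu}}$. A Sheffer-Dunkl sequence $\{s_{n,\nu}(x)\}_{n=0}^\infty$ for the pair $(g(t),f(t))$ is a sequence of polynomials satisfying $\mathrm{L}_f s_{n,\nu}(x)=\frac{\gamma_{n,\nu}}{\gamma_{n-1,\nu}}s_{n-1,\nu}(x)$ or, equivalently (the two conditions are presented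 as equivalent definitions), $$\frac{1}{g(\overline f(t))}E_\nu(x\overline f(t))=\sum_{n=0}^{\infty}s_{n,\nu}(x)\frac{t^n}{\gamma_{n,\nu}}.$$ The associated Dunkl polynomials $\{p_{n,\nu}(x)\}_{n=0}^\infty$ for $f(t)$ are defined by the generating function $E_\nu(x\overline f(t))=\sum_{n=0}^{\infty}p_{n,\nu}(x)\frac{t^n}{\gamma_{n,\nu}}$.
   Formalization: Conditions (i), (ii) do not determine the given g, so the "if" part fails for fixed g; proved instead: (i), (ii) hold iff s is Sheffer-Dunkl for (g,f) for some g with b_0≠0, and for the given g iff they hold with moments also satisfying 1/g(t)=Σ ω_n t^n/γ_n. *)

theory Defs
  imports
    "HOL-Analysis.Analysis"
    "HOL-Computational_Algebra.Polynomial"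
    "HOL-Computational_Algebra.Formal_Power_Series"
begin

definition dunkl_gamma :: "real \<Rightarrow> nat \<Rightarrow> real" where
  "dunkl_gamma \<nu> n =
     (if even n then 2 ^ n * fact (n div 2) * pochhammer (\<nu> + 1) (n div 2)
      else 2 ^ n * fact (n div 2) * pochhammer (\<nu> + 1) (n div 2 + 1))"

(* pcompose p [:0, -1:] is p(-x); the division by [:0, 1:], i.e. by x, is exact,
   see poly_dunkl_op below. *)
definition dunkl_op :: "real \<Rightarrow> real poly \<Rightarrow> real poly" where
  "dunkl_op \<nu> p =
     pderiv p + smult ((2 * \<nu> + 1) / 2) ((p - pcompose p [:0, -1:]) div [:0, 1:])"

lemma poly_dunkl_op:
  assumes "x \<noteq> 0"
  shows "poly (dunkl_op \<nu> p) x =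
           deriv (poly p) x + (2 * \<nu> + 1) / 2 * ((poly p x - poly p (- x)) / x)"
proof -
  define q where "q = p - pcompose p [:0, -1:]"
  have "poly q 0 = 0"
    by (simp add: q_def poly_pcompose)
  then have "[:0, 1:] dvd q"
    using poly_eq_0_iff_dvd[of q 0] by simp
  then have "q = [:0, 1:] * (q div [:0, 1:])"
    by (rule dvd_mult_div_cancel[symmetric])
  then have "poly q x = poly ([:0, 1:] * (q div [:0, 1:])) x"
    by simp
  then have "poly q x = x * poly (q div [:0, 1:]) x"
    by (simp del: mult_pCons_left)
  moreover have "poly q x = poly p x - poly p (- x)"
    by (simp add: q_def poly_pcompose)
  ultimately have "poly (q div [:0, 1:]) x = (poly p x - poly p (- x)) / x"
    using assms by (simp add: field_simps)
  moreover have "deriv (poly p) x = poly (pderiv p) x"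
    by (intro DERIV_imp_deriv poly_DERIV)
  ultimately show ?thesis
    by (simp add: dunkl_op_def q_def)
qed

(* Only finitely many terms are nonzero, since dunkl_op lowers the degree. *)
definition dunkl_translation :: "real \<Rightarrow> real \<Rightarrow> real poly \<Rightarrow> real \<Rightarrow> real" where
  "dunkl_translation \<nu> y p x =
     (\<Sum>n. poly ((dunkl_op \<nu> ^^ n) p) x * y ^ n / dunkl_gamma \<nu> n)"

definition dunkl_series :: "real \<Rightarrow> (nat \<Rightarrow> real) \<Rightarrow> real fps" where
  "dunkl_series \<nu> c = Abs_fps (\<lambda>n. c n / dunkl_gamma \<nu> n)"

definition dunkl_exp :: "real \<Rightarrow> real fps" where
  "dunkl_exp \<nu> = dunkl_series \<nu> (\<lambda>_. 1)"

(* Generating functions are formal power series in t whose coefficients are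
   polynomials in x; fps_const_poly embeds the series in t alone. *)
definition fps_const_poly :: "real fps \<Rightarrow> real poly fps" where
  "fps_const_poly F = Abs_fps (\<lambda>n. [:fps_nth F n:])"

definition dunkl_exp_x :: "real \<Rightarrow> real fps \<Rightarrow> real poly fps" where
  "dunkl_exp_x \<nu> h =
     fps_compose (fps_const_poly (dunkl_exp \<nu>)) (fps_const [:0, 1:] * fps_const_poly h)"

definition associated_dunkl_poly :: "real \<Rightarrow> real fps \<Rightarrow> nat \<Rightarrow> real poly" where
  "associated_dunkl_poly \<nu> f n =
     smult (dunkl_gamma \<nu> n) (fps_nth (dunkl_exp_x \<nu> (fps_inv f)) n)"

definition sheffer_dunkl ::
  "real \<Rightarrow> real fps \<Rightarrow> real fps \<Rightarrow> (nat \<Rightarrow> real poly) \<Rightarrow> bool" where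
  "sheffer_dunkl \<nu> g f s \<longleftrightarrow>
     fps_const_poly (inverse (fps_compose g (fps_inv f))) * dunkl_exp_x \<nu> (fps_inv f) =
       Abs_fps (\<lambda>n. smult (1 / dunkl_gamma \<nu> n) (s n))"

definition bounded_variation_real :: "(real \<Rightarrow> real) \<Rightarrow> bool" where
  "bounded_variation_real \<beta> \<longleftrightarrow>
     (\<exists>M. \<forall>(t :: nat \<Rightarrow> real) n. mono t \<longrightarrow> (\<Sum>i<n. \<bar>\<beta> (t (Suc i)) - \<beta> (t i)\<bar>) \<le> M)"

(* Riemann-Stieltjes (not Henstock-Stieltjes): the gauge has constant radius,
   so fineness only restricts the mesh. *)
definition has_RS_integral ::
  "(real \<Rightarrow> real) \<Rightarrow> (real \<Rightarrow> real) \<Rightarrow> real \<Rightarrow> real \<Rightarrow> real \<Rightarrow> bool" where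
  "has_RS_integral h \<beta> A B I \<longleftrightarrow>
     (\<forall>\<epsilon>>0. \<exists>\<delta>>0. \<forall>D. D tagged_division_of {A..B} \<and> (\<lambda>x. ball x \<delta>) fine D \<longrightarrow>
        \<bar>(\<Sum>(x, K)\<in>D. h x * (\<beta> (Sup K) - \<beta> (Inf K))) - I\<bar> < \<epsilon>)"

(* Improper integral over the whole line; the two endpoints tend to infinity independently. *)
definition has_stieltjes_integral ::
  "(real \<Rightarrow> real) \<Rightarrow> (real \<Rightarrow> real) \<Rightarrow> real \<Rightarrow> bool" where
  "has_stieltjes_integral h \<beta> I \<longleftrightarrow>
     (\<exists>J. (\<forall>A B. A \<le> B \<longrightarrow> has_RS_integral h \<beta> A B (J A B)) \<and>
          ((\<lambda>(A, B). J A B) \<longlongrightarrow> I) (at_bot \<times>\<^sub>F at_top))"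

end

theory Submission
  imports Defs
begin

text \<open>
  Put \<open>h\<close> for the compositional inverse of \<open>f\<close> and \<open>W = \<Sum> \<omega>\<^sub>n t\<^sup>n / \<gamma>\<^sub>n\<close>. The Dunkl operator acts on
  \<open>E(x h(t))\<close> as multiplication by \<open>h(t)\<close>, so integrating the translation of \<open>p\<^sub>n\<close> against a function
  with moments \<open>\<omega>\<close> produces the sequence with generating function \<open>W(h(t)) E(x h(t))\<close>, which is
  Sheffer--Dunkl for \<open>(1 / W, f)\<close>. What remains is Boas' theorem that every real sequence is the moment
  sequence of a function of bounded variation. Here that function is a step function: block \<open>n\<close> of its
  jumps has vanishing moments below \<open>n\<close>, corrects the \<open>n\<close>-th moment left over by the previous
  blocks, and has absolute moments below \<open>n\<close> of size at most \<open>2\<^sup>-\<^sup>n\<close>, so that all the series involved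
  converge absolutely.
\<close>

section \<open>Riemann--Stieltjes integrals\<close>

lemma has_RS_integralD:
  assumes "has_RS_integral h \<beta> A B I" and "\<epsilon> > 0"
  shows "\<exists>\<delta>>0. \<forall>D. D tagged_division_of {A..B} \<and> (\<lambda>x. ball x \<delta>) fine D \<longrightarrow>
      \<bar>(\<Sum>(x, K)\<in>D. h x * (\<beta> (Sup K) - \<beta> (Inf K))) - I\<bar> < \<epsilon>"
  using assms unfolding has_RS_integral_def by simp

lemma ball_fine_mono:
  assumes "(\<lambda>x. ball x d) fine D" and "d \<le> e"
  shows "(\<lambda>x. ball x e) fine D"
  using assms subset_ball[OF assms(2)] unfolding fine_def by blast

lemma has_RS_integral_add:
  assumes "has_RS_integral h1 \<beta> A B I1" and "has_RS_integral h2 \<beta> A B I2"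
  shows "has_RS_integral (\<lambda>x. h1 x + h2 x) \<beta> A B (I1 + I2)"
  unfolding has_RS_integral_def
proof (intro allI impI)
  fix \<epsilon> :: real assume "\<epsilon> > 0"
  then have e2: "\<epsilon> / 2 > 0" by simp
  obtain d1 where d1: "d1 > 0" and
    1: "\<forall>D. D tagged_division_of {A..B} \<and> (\<lambda>x. ball x d1) fine D \<longrightarrow>
        \<bar>(\<Sum>(x, K)\<in>D. h1 x * (\<beta> (Sup K) - \<beta> (Inf K))) - I1\<bar> < \<epsilon> / 2"
    using has_RS_integralD[OF assms(1) e2] by (elim exE conjE)
  obtain d2 where d2: "d2 > 0" and
    2: "\<forall>D. D tagged_division_of {A..B} \<and> (\<lambda>x. ball x d2) fine D \<longrightarrow>
        \<bar>(\<Sum>(x, K)\<in>D. h2 x * (\<beta> (Sup K) - \<beta> (Inf K))) - I2\<bar> < \<epsilon> / 2"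
    using has_RS_integralD[OF assms(2) e2] by (elim exE conjE)
  show "\<exists>\<delta>>0. \<forall>D. D tagged_division_of {A..B} \<and> (\<lambda>x. ball x \<delta>) fine D \<longrightarrow>
      \<bar>(\<Sum>(x, K)\<in>D. (h1 x + h2 x) * (\<beta> (Sup K) - \<beta> (Inf K))) - (I1 + I2)\<bar> < \<epsilon>"
  proof (intro exI[of _ "min d1 d2"] conjI allI impI)
    show "min d1 d2 > 0" using d1 d2 by simp
    fix D assume D: "D tagged_division_of {A..B} \<and> (\<lambda>x. ball x (min d1 d2)) fine D"
    then have "(\<lambda>x. ball x d1) fine D" "(\<lambda>x. ball x d2) fine D"
      using ball_fine_mono[of "min d1 d2" D d1] ball_fine_mono[of "min d1 d2" D d2] by simp_all
    with 1[THEN spec, of D] 2[THEN spec, of D] D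
    have "\<bar>(\<Sum>(x, K)\<in>D. h1 x * (\<beta> (Sup K) - \<beta> (Inf K))) - I1\<bar> < \<epsilon> / 2"
      "\<bar>(\<Sum>(x, K)\<in>D. h2 x * (\<beta> (Sup K) - \<beta> (Inf K))) - I2\<bar> < \<epsilon> / 2" by auto
    moreover have "(\<Sum>(x, K)\<in>D. (h1 x + h2 x) * (\<beta> (Sup K) - \<beta> (Inf K))) =
       (\<Sum>(x, K)\<in>D. h1 x * (\<beta> (Sup K) - \<beta> (Inf K))) +
       (\<Sum>(x, K)\<in>D. h2 x * (\<beta> (Sup K) - \<beta> (Inf K)))"
      by (simp add: split_def sum.distrib distrib_right)
    ultimately show "\<bar>(\<Sum>(x, K)\<in>D. (h1 x + h2 x) * (\<beta> (Sup K) - \<beta> (Inf K))) - (I1 + I2)\<bar> < \<epsilon>"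
      by linarith
  qed
qed

lemma has_RS_integral_cmult:
  assumes "has_RS_integral h \<beta> A B I"
  shows "has_RS_integral (\<lambda>x. c * h x) \<beta> A B (c * I)"
  unfolding has_RS_integral_def
proof (intro allI impI)
  fix \<epsilon> :: real assume "\<epsilon> > 0"
  \<comment> \<open>The summand 1 keeps the quotient meaningful when \<open>c = 0\<close>.\<close>
  then have e: "\<epsilon> / (\<bar>c\<bar> + 1) > 0" by simp
  obtain d where d: "d > 0" and
    1: "\<forall>D. D tagged_division_of {A..B} \<and> (\<lambda>x. ball x d) fine D \<longrightarrow>
        \<bar>(\<Sum>(x, K)\<in>D. h x * (\<beta> (Sup K) - \<beta> (Inf K))) - I\<bar> < \<epsilon> / (\<bar>c\<bar> + 1)"
    using has_RS_integralD[OF assms(1) e] by (elim exE conjE)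
  show "\<exists>\<delta>>0. \<forall>D. D tagged_division_of {A..B} \<and> (\<lambda>x. ball x \<delta>) fine D \<longrightarrow>
      \<bar>(\<Sum>(x, K)\<in>D. c * h x * (\<beta> (Sup K) - \<beta> (Inf K))) - c * I\<bar> < \<epsilon>"
  proof (intro exI[of _ d] conjI allI impI d)
    fix D assume D: "D tagged_division_of {A..B} \<and> (\<lambda>x. ball x d) fine D"
    define S where "S = (\<Sum>(x, K)\<in>D. h x * (\<beta> (Sup K) - \<beta> (Inf K)))"
    have "\<bar>S - I\<bar> * (\<bar>c\<bar> + 1) < \<epsilon>"
      using 1[THEN spec, of D] D by (simp add: S_def pos_less_divide_eq)
    moreover have "(\<Sum>(x, K)\<in>D. c * h x * (\<beta> (Sup K) - \<beta> (Inf K))) = c * S"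
      by (simp add: S_def split_def sum_distrib_left mult.assoc)
    moreover have "\<bar>c * S - c * I\<bar> \<le> \<bar>S - I\<bar> * (\<bar>c\<bar> + 1)"
      by (simp add: abs_mult distrib_left flip: right_diff_distrib)
    ultimately show "\<bar>(\<Sum>(x, K)\<in>D. c * h x * (\<beta> (Sup K) - \<beta> (Inf K))) - c * I\<bar> < \<epsilon>"
      by linarith
  qed
qed

text \<open>By Cousin's lemma some tagged division is fine for both radii. Its single
  Riemann-Stieltjes sum would then be closer than half of \<open>\<bar>I1 - I2\<bar>\<close> to both
  values.\<close>

lemma has_RS_integral_unique:
  assumes "has_RS_integral h \<beta> A B I1" and "has_RS_integral h \<beta> A B I2"
  shows "I1 = I2"
proof (rule ccontr)
  assume "I1 \<noteq> I2"
  then have e: "\<bar>I1 - I2\<bar> / 2 > 0" by simp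
  obtain d1 where d1: "d1 > 0" and
    1: "\<forall>D. D tagged_division_of {A..B} \<and> (\<lambda>x. ball x d1) fine D \<longrightarrow>
        \<bar>(\<Sum>(x, K)\<in>D. h x * (\<beta> (Sup K) - \<beta> (Inf K))) - I1\<bar> < \<bar>I1 - I2\<bar> / 2"
    using has_RS_integralD[OF assms(1) e] by (elim exE conjE)
  obtain d2 where d2: "d2 > 0" and
    2: "\<forall>D. D tagged_division_of {A..B} \<and> (\<lambda>x. ball x d2) fine D \<longrightarrow>
        \<bar>(\<Sum>(x, K)\<in>D. h x * (\<beta> (Sup K) - \<beta> (Inf K))) - I2\<bar> < \<bar>I1 - I2\<bar> / 2"
    using has_RS_integralD[OF assms(2) e] by (elim exE conjE)
  have "gauge (\<lambda>x. ball x (min d1 d2))"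
    using d1 d2 by (intro gauge_ball) simp
  then obtain D where D: "D tagged_division_of {A..B}" "(\<lambda>x. ball x (min d1 d2)) fine D"
    by (rule fine_division_exists_real)
  then have fine: "(\<lambda>x. ball x d1) fine D" "(\<lambda>x. ball x d2) fine D"
    using ball_fine_mono[of "min d1 d2" D d1] ball_fine_mono[of "min d1 d2" D d2] by simp_all
  have "\<bar>S - I1\<bar> < e \<Longrightarrow> \<bar>S - I2\<bar> < e \<Longrightarrow> \<bar>I1 - I2\<bar> < 2 * e" for S e
    by linarith
  from this[OF mp[OF spec[OF 1] conjI[OF D(1) fine(1)]] mp[OF spec[OF 2] conjI[OF D(1) fine(2)]]]
  show False by simp
qed

section \<open>Improper Stieltjes integrals: linearity and uniqueness\<close>

lemma has_stieltjes_integral_add: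
  assumes "has_stieltjes_integral h1 \<beta> I1" and "has_stieltjes_integral h2 \<beta> I2"
  shows "has_stieltjes_integral (\<lambda>x. h1 x + h2 x) \<beta> (I1 + I2)"
proof -
  obtain J1 where J1: "\<And>A B. A \<le> B \<Longrightarrow> has_RS_integral h1 \<beta> A B (J1 A B)"
      "((\<lambda>(A, B). J1 A B) \<longlongrightarrow> I1) (at_bot \<times>\<^sub>F at_top)"
    using assms(1) unfolding has_stieltjes_integral_def by blast
  obtain J2 where J2: "\<And>A B. A \<le> B \<Longrightarrow> has_RS_integral h2 \<beta> A B (J2 A B)"
      "((\<lambda>(A, B). J2 A B) \<longlongrightarrow> I2) (at_bot \<times>\<^sub>F at_top)"
    using assms(2) unfolding has_stieltjes_integral_def by blast
  show ?thesis
    unfolding has_stieltjes_integral_def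
    using J1(1) J2(1) tendsto_add[OF J1(2) J2(2)]
    by (intro exI[of _ "\<lambda>A B. J1 A B + J2 A B"]) (auto simp: split_def has_RS_integral_add)
qed

lemma has_stieltjes_integral_cmult:
  assumes "has_stieltjes_integral h \<beta> I"
  shows "has_stieltjes_integral (\<lambda>x. c * h x) \<beta> (c * I)"
proof -
  obtain J where J: "\<And>A B. A \<le> B \<Longrightarrow> has_RS_integral h \<beta> A B (J A B)"
      "((\<lambda>(A, B). J A B) \<longlongrightarrow> I) (at_bot \<times>\<^sub>F at_top)"
    using assms(1) unfolding has_stieltjes_integral_def by blast
  show ?thesis
    unfolding has_stieltjes_integral_def
    using J(1) tendsto_mult_left[OF J(2), of c]
    by (intro exI[of _ "\<lambda>A B. c * J A B"]) (auto simp: split_def has_RS_integral_cmult)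
qed

lemma has_stieltjes_integral_zero: "has_stieltjes_integral (\<lambda>x. 0) \<beta> 0"
  unfolding has_stieltjes_integral_def has_RS_integral_def
  by (intro exI[of _ "\<lambda>_ _. 0"]) (auto simp: split_def intro: exI[of _ 1])

lemma has_stieltjes_integral_sum:
  assumes "finite S" and "\<And>k. k \<in> S \<Longrightarrow> has_stieltjes_integral (h k) \<beta> (I k)"
  shows "has_stieltjes_integral (\<lambda>x. \<Sum>k\<in>S. h k x) \<beta> (\<Sum>k\<in>S. I k)"
  using assms
  by (induction S) (auto intro: has_stieltjes_integral_zero has_stieltjes_integral_add)

lemma has_stieltjes_integral_unique:
  assumes "has_stieltjes_integral h \<beta> I1" and "has_stieltjes_integral h \<beta> I2"
  shows "I1 = I2"
proof -
  obtain J1 where J1: "\<And>A B. A \<le> B \<Longrightarrow> has_RS_integral h \<beta> A B (J1 A B)"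
      "((\<lambda>(A, B). J1 A B) \<longlongrightarrow> I1) (at_bot \<times>\<^sub>F at_top)"
    using assms(1) unfolding has_stieltjes_integral_def by blast
  obtain J2 where J2: "\<And>A B. A \<le> B \<Longrightarrow> has_RS_integral h \<beta> A B (J2 A B)"
      "((\<lambda>(A, B). J2 A B) \<longlongrightarrow> I2) (at_bot \<times>\<^sub>F at_top)"
    using assms(2) unfolding has_stieltjes_integral_def by blast
  \<comment> \<open>\<open>J1\<close> and \<open>J2\<close> are constrained only where
    \<open>A \<le> B\<close>; separating the endpoints by 0 ensures this eventually along the
    product filter.\<close>
  have "eventually (\<lambda>p. fst p \<le> (0::real) \<and> snd p \<ge> (0::real)) (at_bot \<times>\<^sub>F (at_top :: real filter))"
    by (intro eventually_conj eventually_compose_filterlim[OF eventually_le_at_bot filterlim_fst]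
        eventually_compose_filterlim[OF eventually_ge_at_top filterlim_snd])
  then have "eventually (\<lambda>p. (case p of (A, B) \<Rightarrow> J1 A B) = (case p of (A, B) \<Rightarrow> J2 A B))
      (at_bot \<times>\<^sub>F (at_top :: real filter))"
    by eventually_elim
      (auto simp: split_def intro!: has_RS_integral_unique[OF J1(1) J2(1)])
  then have "((\<lambda>(A, B). J2 A B) \<longlongrightarrow> I1) (at_bot \<times>\<^sub>F at_top)"
    using J1(2) tendsto_cong by blast
  then show ?thesis
    by (rule tendsto_unique[rotated, OF _ J2(2)]) (simp add: prod_filter_eq_bot)
qed

text \<open>The increment of \<open>H\<close> over \<open>{u..v}\<close> is nonzero only if
  \<open>u < p \<le> v\<close>, and then the tag is within \<open>\<delta>\<close> of
  \<open>p\<close>. The increments are nonnegative and telescope to at most 1, so the total error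
  stays below \<open>\<epsilon>\<close>. The bound does not depend on \<open>p\<close>, so it can
  later be summed over infinitely many jumps.\<close>

lemma RS_sum_step_error:
  fixes h :: "real \<Rightarrow> real" and p :: real
  assumes "A \<le> B" and D: "D tagged_division_of {A..B}" and fine: "(\<lambda>x. ball x \<delta>) fine D"
    and h: "\<And>x y. x \<in> {A..B} \<Longrightarrow> y \<in> {A..B} \<Longrightarrow> dist x y < \<delta> \<Longrightarrow> \<bar>h x - h y\<bar> \<le> \<epsilon>"
    and "\<epsilon> \<ge> 0"
  defines "H \<equiv> indicator {p..} :: real \<Rightarrow> real"
  shows "\<bar>(\<Sum>(x, K)\<in>D. h x * (H (Sup K) - H (Inf K))) - h p * (H B - H A)\<bar> \<le> \<epsilon>"
proof -
  let ?d = "\<lambda>K. H (Sup K) - H (Inf K)"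
  have tel: "(\<Sum>(x, K)\<in>D. ?d K) = H B - H A"
    by (rule additive_tagged_division_1[OF assms(1) D])
  have dev: "\<bar>(h x - h p) * ?d K\<bar> \<le> \<epsilon> * ?d K" if xKD: "(x, K) \<in> D" for x K
  proof -
    have xK: "x \<in> K" "K \<subseteq> {A..B}" "K \<subseteq> ball x \<delta>"
      using D fine that by (auto simp: fine_def)
    obtain u v where "K = cbox u v" using tagged_division_ofD(4)[OF D xKD] by (elim exE)
    with xK have K: "K = {u..v}" "u \<le> v" by auto
    show ?thesis
    proof (cases "u < p \<and> p \<le> v")
      case True
      then have "p \<in> K" using K by auto
      then have "\<bar>h x - h p\<bar> \<le> \<epsilon>" using xK by (intro h) auto
      then show ?thesis using True K by (simp add: H_def)
    next
      case False
      then show ?thesis using K by (auto simp: H_def indicator_def)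
    qed
  qed
  have "(\<Sum>(x, K)\<in>D. h x * ?d K) - h p * (H B - H A) = (\<Sum>(x, K)\<in>D. (h x - h p) * ?d K)"
  proof -
    have hp: "h p * (H B - H A) = (\<Sum>(x, K)\<in>D. h p * ?d K)"
      unfolding tel[symmetric] by (simp only: split_def sum_distrib_left)
    show ?thesis
      unfolding hp by (simp only: split_def left_diff_distrib sum_subtractf)
  qed
  also have "\<bar>\<dots>\<bar> \<le> (\<Sum>(x, K)\<in>D. \<epsilon> * ?d K)"
    by (rule order_trans[OF sum_abs], rule sum_mono) (use dev in auto)
  also have "\<dots> = \<epsilon> * (H B - H A)"
    unfolding tel[symmetric] by (simp only: split_def sum_distrib_left)
  also have "\<dots> \<le> \<epsilon>"
    using \<open>\<epsilon> \<ge> 0\<close> by (auto simp: H_def indicator_def)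
  finally show ?thesis .
qed

section \<open>Pure jump functions as integrators\<close>

definition block_step :: "(nat \<Rightarrow> real) \<Rightarrow> (nat \<Rightarrow> real) \<Rightarrow> nat \<Rightarrow> real \<Rightarrow> real" where
  "block_step u p n x = (\<Sum>k\<le>n. u k * indicator {p k..} x)"

lemma abs_block_step_le: "\<bar>block_step u p n x\<bar> \<le> (\<Sum>k\<le>n. \<bar>u k\<bar>)"
  unfolding block_step_def
  by (rule order_trans[OF sum_abs], rule sum_mono) (auto simp: indicator_def)

text \<open>Block \<open>n\<close> has jumps \<open>u n k\<close> at the points \<open>p n k\<close>
  for \<open>k \<le> n\<close>. The case \<open>j = 0\<close> of the summability bounds the total
  variation, the other cases make the moment series converge absolutely. Nonnegative jump points
  leave only the upper endpoint to pass to the limit.\<close>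

locale summable_blocks =
  fixes u p :: "nat \<Rightarrow> nat \<Rightarrow> real"
  assumes p_nonneg: "p n k \<ge> 0"
    and summable_moments: "summable (\<lambda>n. \<Sum>k\<le>n. \<bar>u n k\<bar> * p n k ^ j)"
begin

definition jump_fun :: "real \<Rightarrow> real" where
  "jump_fun x = (\<Sum>n. block_step (u n) (p n) n x)"

lemma summable_weights: "summable (\<lambda>n. \<Sum>k\<le>n. \<bar>u n k\<bar>)"
  using summable_moments[of 0] by simp

lemma summable_block_step: "summable (\<lambda>n. block_step (u n) (p n) n x)"
  by (rule summable_comparison_test'[OF summable_weights, of 0]) (simp add: abs_block_step_le)

text \<open>Replacing the weights by their absolute values gives a function \<open>V\<close> with
  values in \<open>[0, M]\<close> whose increments dominate those of \<open>jump_fun\<close>; along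
  a monotone sequence these increments telescope.\<close>

lemma bounded_variation_jump_fun: "bounded_variation_real jump_fun"
proof -
  define V where "V x = (\<Sum>n. block_step (\<lambda>k. \<bar>u n k\<bar>) (p n) n x)" for x
  have sV: "summable (\<lambda>n. block_step (\<lambda>k. \<bar>u n k\<bar>) (p n) n x)" for x
    by (rule summable_comparison_test'[OF summable_weights, of 0])
      (use abs_block_step_le[of "\<lambda>k. \<bar>u n k\<bar>" "p n" n x for n] in simp)
  define M where "M = (\<Sum>n. \<Sum>k\<le>n. \<bar>u n k\<bar>)"
  have V0: "0 \<le> V x" for x
    unfolding V_def by (intro suminf_nonneg sV) (simp add: block_step_def sum_nonneg)
  have VM: "V x \<le> M" for x
    unfolding V_def M_def
  proof (intro suminf_le sV summable_weights)
    show "block_step (\<lambda>k. \<bar>u n k\<bar>) (p n) n x \<le> (\<Sum>k\<le>n. \<bar>u n k\<bar>)" for n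
      using abs_block_step_le[of "\<lambda>k. \<bar>u n k\<bar>" "p n" n x] by simp
  qed
  have diff: "\<bar>jump_fun y - jump_fun x\<bar> \<le> V y - V x" if "x \<le> y" for x y
  proof -
    have "jump_fun y - jump_fun x = (\<Sum>n. block_step (u n) (p n) n y - block_step (u n) (p n) n x)"
      unfolding jump_fun_def by (intro suminf_diff summable_block_step)
    also have "norm \<dots> \<le> (\<Sum>n. block_step (\<lambda>k. \<bar>u n k\<bar>) (p n) n y - block_step (\<lambda>k. \<bar>u n k\<bar>) (p n) n x)"
    proof (rule norm_suminf_le)
      show "norm (block_step (u n) (p n) n y - block_step (u n) (p n) n x)
          \<le> block_step (\<lambda>k. \<bar>u n k\<bar>) (p n) n y - block_step (\<lambda>k. \<bar>u n k\<bar>) (p n) n x" for n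
        unfolding block_step_def real_norm_def sum_subtractf[symmetric]
        by (rule order_trans[OF sum_abs], rule sum_mono) (use that in \<open>auto simp: indicator_def\<close>)
    qed (intro summable_diff sV)
    also have "\<dots> = V y - V x"
      unfolding V_def by (intro suminf_diff[symmetric] sV)
    finally show ?thesis by simp
  qed
  show ?thesis
    unfolding bounded_variation_real_def
  proof (intro exI[of _ M] allI impI)
    fix t :: "nat \<Rightarrow> real" and n assume "mono t"
    then have "(\<Sum>i<n. \<bar>jump_fun (t (Suc i)) - jump_fun (t i)\<bar>) \<le> (\<Sum>i<n. V (t (Suc i)) - V (t i))"
      by (intro sum_mono diff) (simp add: mono_def)
    also have "\<dots> = V (t n) - V (t 0)"
      by (rule sum_lessThan_telescope)
    also have "\<dots> \<le> M"
      using V0[of "t 0"] VM[of "t n"] by linarith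
    finally show "(\<Sum>i<n. \<bar>jump_fun (t (Suc i)) - jump_fun (t i)\<bar>) \<le> M" .
  qed
qed

text \<open>Uniform continuity of \<open>h\<close> on \<open>{A..B}\<close> provides one mesh that
  serves all jumps at once. The error of each jump is at most \<open>e\<close> times its absolute
  weight, and the weights are summable. The difference of indicators selects the jump points in the
  half-open interval from \<open>A\<close> (excluded) to \<open>B\<close> (included).\<close>

lemma has_RS_integral_jump_fun:
  assumes "A \<le> B" and cont: "continuous_on UNIV h"
    and sum_h: "summable (\<lambda>n. \<Sum>k\<le>n. \<bar>u n k * h (p n k)\<bar>)"
  shows "has_RS_integral h jump_fun A B
    (\<Sum>n. \<Sum>k\<le>n. u n k * h (p n k) * (indicator {p n k..} B - indicator {p n k..} A))"
    (is "has_RS_integral _ _ _ _ (\<Sum>n. ?J n)")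
  unfolding has_RS_integral_def
proof (intro allI impI)
  fix \<epsilon> :: real assume "\<epsilon> > 0"
  define M where "M = (\<Sum>n. \<Sum>k\<le>n. \<bar>u n k\<bar>)"
  have M: "M \<ge> 0" unfolding M_def by (intro suminf_nonneg summable_weights sum_nonneg) auto
  \<comment> \<open>Dividing by \<open>M + 1\<close> rather than \<open>M\<close> covers
    \<open>M = 0\<close> and makes \<open>e * M < \<epsilon>\<close> strict.\<close>
  define e where "e = \<epsilon> / (M + 1)"
  have e: "e > 0" "e * M < \<epsilon>"
    using M \<open>\<epsilon> > 0\<close> by (auto simp: e_def field_simps)
  have "uniformly_continuous_on {A..B} h"
    by (rule compact_uniformly_continuous) (auto intro: continuous_on_subset[OF cont])
  then obtain \<delta> where d: "\<delta> > 0" and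
    h: "\<And>x y. x \<in> {A..B} \<Longrightarrow> y \<in> {A..B} \<Longrightarrow> dist x y < \<delta> \<Longrightarrow> \<bar>h x - h y\<bar> \<le> e"
    using e(1) unfolding uniformly_continuous_on_def dist_real_def
    by (metis less_imp_le)
  have sJ: "summable ?J"
    by (rule summable_comparison_test'[OF sum_h, of 0])
      (auto intro!: order_trans[OF sum_abs] sum_mono simp: indicator_def)
  show "\<exists>\<delta>>0. \<forall>D. D tagged_division_of {A..B} \<and> (\<lambda>x. ball x \<delta>) fine D \<longrightarrow>
      \<bar>(\<Sum>(x, K)\<in>D. h x * (jump_fun (Sup K) - jump_fun (Inf K))) - (\<Sum>n. ?J n)\<bar> < \<epsilon>"
  proof (intro exI[of _ \<delta>] conjI allI impI d)
    fix D assume D: "D tagged_division_of {A..B} \<and> (\<lambda>x. ball x \<delta>) fine D"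
    let ?b = "\<lambda>n. block_step (u n) (p n) n"
    let ?H = "\<lambda>n k. indicator {p n k..} :: real \<Rightarrow> real"
    define S where "S n = (\<Sum>(x, K)\<in>D. h x * (?b n (Sup K) - ?b n (Inf K)))" for n
    have sS: "summable S"
      unfolding S_def split_def
      by (intro summable_sum summable_mult summable_diff summable_block_step)
    have "(\<Sum>(x, K)\<in>D. h x * (jump_fun (Sup K) - jump_fun (Inf K))) =
        (\<Sum>(x, K)\<in>D. \<Sum>n. h x * (?b n (Sup K) - ?b n (Inf K)))"
      unfolding jump_fun_def split_def
      by (intro sum.cong refl)
        (simp add: suminf_diff suminf_mult summable_diff summable_block_step)
    also have "\<dots> = suminf S"
      unfolding S_def split_def
      by (intro suminf_sum[symmetric] summable_mult summable_diff summable_block_step)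
    finally have eq: "(\<Sum>(x, K)\<in>D. h x * (jump_fun (Sup K) - jump_fun (Inf K))) - (\<Sum>n. ?J n)
        = (\<Sum>n. S n - ?J n)"
      using suminf_diff[OF sS sJ] by simp
    have "norm (\<Sum>n. S n - ?J n) \<le> (\<Sum>n. e * (\<Sum>k\<le>n. \<bar>u n k\<bar>))"
    proof (rule norm_suminf_le[OF _ summable_mult[OF summable_weights]])
      fix n
      \<comment> \<open>Swapping the two finite sums isolates single jumps, to which
        \<open>RS_sum_step_error\<close> applies.\<close>
      have "S n = (\<Sum>k\<le>n. u n k * (\<Sum>(x, K)\<in>D. h x * (?H n k (Sup K) - ?H n k (Inf K))))"
        unfolding S_def block_step_def split_def sum_distrib_left sum_subtractf[symmetric]
        by (subst sum.swap) (simp add: algebra_simps)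
      then have "S n - ?J n = (\<Sum>k\<le>n. u n k * ((\<Sum>(x, K)\<in>D. h x * (?H n k (Sup K) - ?H n k (Inf K)))
          - h (p n k) * (?H n k B - ?H n k A)))"
        by (simp add: sum_subtractf right_diff_distrib mult.assoc)
      also have "\<bar>\<dots>\<bar> \<le> (\<Sum>k\<le>n. \<bar>u n k\<bar> * e)"
        using D e h
        by (intro order_trans[OF sum_abs] sum_mono)
          (auto simp: abs_mult intro!: mult_left_mono RS_sum_step_error[OF \<open>A \<le> B\<close>])
      finally show "norm (S n - ?J n) \<le> e * (\<Sum>k\<le>n. \<bar>u n k\<bar>)"
        by (simp add: sum_distrib_left mult.commute)
    qed
    also have "\<dots> = e * M"
      unfolding M_def by (rule suminf_mult[OF summable_weights])
    finally show "\<bar>(\<Sum>(x, K)\<in>D. h x * (jump_fun (Sup K) - jump_fun (Inf K))) - (\<Sum>n. ?J n)\<bar> < \<epsilon>"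
      using e(2) unfolding eq by simp
  qed
qed

text \<open>Tannery's theorem, with the absolute series \<open>sum_h\<close> as majorant, moves the
  limit \<open>B\<close> to infinity inside the series over blocks.\<close>

lemma has_stieltjes_integral_jump_fun:
  assumes cont: "continuous_on UNIV h"
    and sum_h: "summable (\<lambda>n. \<Sum>k\<le>n. \<bar>u n k * h (p n k)\<bar>)"
  shows "has_stieltjes_integral h jump_fun (\<Sum>n. \<Sum>k\<le>n. u n k * h (p n k))"
  unfolding has_stieltjes_integral_def
proof (intro exI conjI allI impI)
  show "has_RS_integral h jump_fun A B
    (\<Sum>n. \<Sum>k\<le>n. u n k * h (p n k) * (indicator {p n k..} B - indicator {p n k..} A))" if "A \<le> B" for A B
    by (rule has_RS_integral_jump_fun[OF that assms])
  let ?H = "\<lambda>n k. indicator {p n k..} :: real \<Rightarrow> real"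
  define F where "F n B = (\<Sum>k\<le>n. u n k * h (p n k) * ?H n k B)" for n B
  have "((\<lambda>B. F n B) \<longlongrightarrow> (\<Sum>k\<le>n. u n k * h (p n k) * 1)) at_top" for n
    unfolding F_def
  proof (intro tendsto_intros)
    show "(?H n k \<longlongrightarrow> 1) at_top" for k
      by (rule tendsto_eventually)
        (use eventually_ge_at_top[of "p n k"] in \<open>eventually_elim, auto\<close>)
  qed
  moreover have "eventually (\<lambda>(n, B). norm (F n B) \<le> (\<Sum>k\<le>n. \<bar>u n k * h (p n k)\<bar>)) (at_top \<times>\<^sub>F at_top)"
  proof -
    have "norm (F n B) \<le> (\<Sum>k\<le>n. \<bar>u n k * h (p n k)\<bar>)" for n B
      unfolding F_def real_norm_def
      by (rule order_trans[OF sum_abs], rule sum_mono) (auto simp: indicator_def)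
    then show ?thesis by (intro always_eventually) (simp add: split_def)
  qed
  ultimately have "((\<lambda>B. \<Sum>n. F n B) \<longlongrightarrow> (\<Sum>n. \<Sum>k\<le>n. u n k * h (p n k) * 1)) at_top"
    using tannerys_theorem[of F "\<lambda>n. \<Sum>k\<le>n. u n k * h (p n k) * 1" at_top
        "\<lambda>n. \<Sum>k\<le>n. \<bar>u n k * h (p n k)\<bar>"] sum_h by simp
  then have lim: "((\<lambda>x. \<Sum>n. F n (snd x)) \<longlongrightarrow> (\<Sum>n. \<Sum>k\<le>n. u n k * h (p n k))) (at_bot \<times>\<^sub>F at_top)"
    using filterlim_compose[OF _ filterlim_snd] by simp
  \<comment> \<open>Below 0 there is no jump, so the contribution of the lower endpoint vanishes as
    soon as \<open>A < 0\<close>.\<close>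
  have "eventually (\<lambda>x. fst x < (0::real)) (at_bot \<times>\<^sub>F (at_top :: real filter))"
    by (rule eventually_compose_filterlim[OF eventually_gt_at_bot filterlim_fst])
  then have "eventually (\<lambda>x. (\<Sum>n. F n (snd x)) = (case x of (A, B) \<Rightarrow>
      \<Sum>n. \<Sum>k\<le>n. u n k * h (p n k) * (?H n k B - ?H n k A))) (at_bot \<times>\<^sub>F at_top)"
  proof eventually_elim
    case (elim x)
    then have "?H n k (fst x) = 0" for n k
      using p_nonneg[of n k] by simp
    then show ?case by (simp add: F_def split_def)
  qed
  from iffD1[OF tendsto_cong[OF this] lim] show "((\<lambda>(A, B). \<Sum>n. \<Sum>k\<le>n. u n k * h (p n k) * (?H n k B - ?H n k A)) \<longlongrightarrow>
      (\<Sum>n. \<Sum>k\<le>n. u n k * h (p n k))) (at_bot \<times>\<^sub>F at_top)" .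
qed

end

section \<open>Step functions with prescribed moments\<close>

text \<open>The sum is the coefficient of \<open>t\<^sup>j\<close> in \<open>(e\<^sup>t - 1)\<^sup>n\<close>, up to the factor \<open>j! / n!\<close>.\<close>

lemma finite_difference_moments:
  assumes "j \<le> n"
  shows "(\<Sum>k\<le>n. (-1) ^ (n - k) * real (n choose k) / fact n * real k ^ j) = (if j = n then 1 else 0)"
proof -
  let ?E = "fps_exp (1::real)"
  have "(?E - 1) ^ n = (\<Sum>k\<le>n. of_nat (n choose k) * ?E ^ k * (-1) ^ (n - k))"
    using binomial_ring[of ?E "-1" n] by simp
  then have "fps_nth ((?E - 1) ^ n) j = (\<Sum>k\<le>n. fps_nth (of_nat (n choose k) * ?E ^ k * (-1) ^ (n - k)) j)"
    by (simp add: fps_sum_nth)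
  also have "\<dots> = (\<Sum>k\<le>n. (-1) ^ (n - k) * real (n choose k) * real k ^ j / fact j)"
  proof (intro sum.cong refl)
    fix k
    have "of_nat (n choose k) * ?E ^ k * (-1) ^ (n - k)
        = fps_const ((-1) ^ (n - k) * real (n choose k)) * fps_exp (real k)"
    proof -
      have "(-1 :: real fps) ^ (n - k) = fps_const ((-1) ^ (n - k))"
        by (simp only: fps_const_power[symmetric] fps_const_neg[symmetric] fps_const_1_eq_1)
      then show ?thesis
        by (simp only: fps_exp_power_mult fps_of_nat[symmetric] fps_const_mult[symmetric] mult_1_right)
          (simp only: mult_ac)
    qed
    then show "fps_nth (of_nat (n choose k) * ?E ^ k * (-1) ^ (n - k)) j =
        (-1) ^ (n - k) * real (n choose k) * real k ^ j / fact j"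
      by simp
  qed
  finally have 1: "(\<Sum>k\<le>n. (-1) ^ (n - k) * real (n choose k) * real k ^ j) = fact j * fps_nth ((?E - 1) ^ n) j"
    by (simp flip: sum_divide_distrib)
  \<comment> \<open>The series \<open>?E - 1\<close> starts with \<open>t\<close>, so its
    \<open>n\<close>-th power starts with \<open>t ^ n\<close>, with coefficient 1.\<close>
  have "fps_nth ((?E - 1) ^ n) j = (if j = n then 1 else 0)"
    using assms startsby_zero_power_prefix[of "?E - 1" n] startsby_zero_power_nth_same[of "?E - 1" n]
    by auto
  with 1 show ?thesis
    by (simp add: sum_divide_distrib[symmetric])
qed

text \<open>Dilating the finite difference functional by \<open>R\<close> and dividing its weights by \<open>R ^ n\<close> keeps the
  \<open>n\<close>-th moment, while the lower absolute moments become \<open>O(1 / R)\<close>.\<close>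

lemma ex_block:
  fixes c :: real
  shows "\<exists>u p :: nat \<Rightarrow> real. (\<forall>k. p k \<ge> 0) \<and> (\<Sum>k\<le>n. u k * p k ^ n) = c \<and>
    (\<forall>j<n. (\<Sum>k\<le>n. u k * p k ^ j) = 0 \<and> (\<Sum>k\<le>n. \<bar>u k\<bar> * p k ^ j) \<le> (1 / 2) ^ n)"
proof -
  define w where "w k = (-1) ^ (n - k) * real (n choose k) / fact n" for k
  define L where "L = (\<Sum>j<n. \<Sum>k\<le>n. \<bar>w k\<bar> * real k ^ j)"
  \<comment> \<open>\<open>L\<close> dominates each absolute moment of \<open>w\<close> of order
    below \<open>n\<close>. The choice of \<open>R\<close> gives
    \<open>\<bar>c\<bar> * L / R \<le> (1 / 2) ^ n\<close>, and the summand 1 gives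
    \<open>R \<ge> 1\<close>, hence \<open>R * R ^ j \<le> R ^ n\<close> for
    \<open>j < n\<close>.\<close>
  define R where "R = 1 + \<bar>c\<bar> * L * 2 ^ n"
  have L: "L \<ge> 0" unfolding L_def by (intro sum_nonneg) auto
  then have R: "R \<ge> 1" by (simp add: R_def)
  define u where "u k = c / R ^ n * w k" for k
  define p where "p k = R * real k" for k
  have mom: "(\<Sum>k\<le>n. u k * p k ^ j) = c / R ^ n * R ^ j * (if j = n then 1 else 0)" if "j \<le> n" for j
  proof -
    have "(\<Sum>k\<le>n. u k * p k ^ j) = c / R ^ n * R ^ j * (\<Sum>k\<le>n. w k * real k ^ j)"
      by (simp add: u_def p_def power_mult_distrib sum_distrib_left mult_ac)
    then show ?thesis
      using finite_difference_moments[OF that] by (simp add: w_def)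
  qed
  have "(\<Sum>k\<le>n. \<bar>u k\<bar> * p k ^ j) \<le> (1 / 2) ^ n" if "j < n" for j
  proof -
    have "(\<Sum>k\<le>n. \<bar>w k\<bar> * real k ^ j) \<le> L"
      unfolding L_def by (rule member_le_sum) (use that in \<open>auto intro: sum_nonneg\<close>)
    moreover have "R * R ^ j \<le> R ^ n"
      using power_increasing[of "Suc j" n R] that R by simp
    moreover have "(\<Sum>k\<le>n. \<bar>u k\<bar> * p k ^ j) = \<bar>c\<bar> * (\<Sum>k\<le>n. \<bar>w k\<bar> * real k ^ j) * (R ^ j / R ^ n)"
      using R by (simp add: u_def p_def abs_mult power_mult_distrib sum_distrib_left sum_distrib_right mult_ac)
    moreover have "R ^ j / R ^ n \<le> 1 / R" if "R * R ^ j \<le> R ^ n"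
      using that R by (simp add: field_simps)
    ultimately have "(\<Sum>k\<le>n. \<bar>u k\<bar> * p k ^ j) \<le> \<bar>c\<bar> * L * (1 / R)"
      using R L by (simp only:) (intro mult_mono, auto intro: sum_nonneg)
    also have "\<dots> \<le> (1 / 2) ^ n"
    proof -
      have "\<bar>c\<bar> * L * 2 ^ n \<le> R" by (simp add: R_def)
      then show ?thesis using R by (simp add: field_simps)
    qed
    finally show ?thesis .
  qed
  then show ?thesis
    using mom R by (intro exI[of _ u] exI[of _ p]) (auto simp: p_def)
qed

text \<open>The conditions on the blocks are triangular: block \<open>n\<close> does not affect
  moments of order below \<open>n\<close>, so the blocks can be chosen one after the other, block
  \<open>j\<close> fixing the \<open>j\<close>-th moment for good.\<close>

lemma ex_bounded_variation_moments:
  fixes \<omega> :: "nat \<Rightarrow> real"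
  shows "\<exists>\<beta>. bounded_variation_real \<beta> \<and> (\<forall>j. has_stieltjes_integral (\<lambda>x. x ^ j) \<beta> (\<omega> j))"
proof -
  define mom where "mom n j b = (\<Sum>k\<le>n. fst b k * snd b k ^ j)"
    for n j :: nat and b :: "(nat \<Rightarrow> real) \<times> (nat \<Rightarrow> real)"
  \<comment> \<open>\<open>P b n r\<close> says that \<open>r\<close>, a pair of weights and jump
    points, is admissible as block \<open>n\<close> after the blocks \<open>b m\<close> with
    \<open>m < n\<close>.\<close>
  define P where "P b n r \<longleftrightarrow> (\<forall>k. snd r k \<ge> 0) \<and> mom n n r = \<omega> n - (\<Sum>m<n. mom m n (b m)) \<and>
    (\<forall>j<n. mom n j r = 0 \<and> (\<Sum>k\<le>n. \<bar>fst r k\<bar> * snd r k ^ j) \<le> (1 / 2) ^ n)"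
    for b :: "nat \<Rightarrow> (nat \<Rightarrow> real) \<times> (nat \<Rightarrow> real)" and n r
  have "\<exists>b. \<forall>n. P b n (b n)"
  proof (rule dependent_wellorder_choice)
    show "P b n r = P b' n r" if "\<And>m. m < n \<Longrightarrow> b m = b' m" for r b b' n
      using that by (simp add: P_def)
    show "\<exists>r. P b n r" for b n
      using ex_block[of n "\<omega> n - (\<Sum>m<n. mom m n (b m))"] by (auto simp: P_def mom_def)
  qed
  then obtain b where b: "\<And>n. P b n (b n)" by blast
  define u where "u n = fst (b n)" for n
  define p where "p n = snd (b n)" for n
  interpret summable_blocks u p
  proof
    show "p n k \<ge> 0" for n k using b[of n] by (simp add: P_def p_def)
    \<comment> \<open>The geometric bound on the \<open>j\<close>-th absolute moment holds only for
      blocks with \<open>j < n\<close>, so the comparison starts at \<open>Suc j\<close>.\<close>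
    show "summable (\<lambda>n. \<Sum>k\<le>n. \<bar>u n k\<bar> * p n k ^ j)" for j
    proof (rule summable_comparison_test'[of "\<lambda>n. (1 / 2) ^ n" "Suc j"])
      show "summable (\<lambda>n. (1 / 2 :: real) ^ n)" by (simp add: summable_geometric)
      show "norm (\<Sum>k\<le>n. \<bar>u n k\<bar> * p n k ^ j) \<le> (1 / 2) ^ n" if "Suc j \<le> n" for n
        using b[of n] that by (simp add: P_def p_def u_def sum_nonneg)
    qed
  qed
  have "has_stieltjes_integral (\<lambda>x. x ^ j) jump_fun (\<omega> j)" for j
  proof -
    \<comment> \<open>All blocks beyond \<open>j\<close> have zero \<open>j\<close>-th moment, so
      the series is a finite sum whose last term supplies exactly what the earlier ones leave
      over.\<close>
    have "(\<Sum>n. \<Sum>k\<le>n. u n k * p n k ^ j) = (\<Sum>n\<le>j. mom n j (b n))"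
      unfolding u_def p_def mom_def[symmetric]
      by (rule suminf_finite) (use b in \<open>auto simp: P_def\<close>)
    also have "\<dots> = \<omega> j"
      using b[of j] by (simp add: P_def flip: lessThan_Suc_atMost)
    finally show ?thesis
      using has_stieltjes_integral_jump_fun[of "\<lambda>x. x ^ j"] summable_moments[of j] p_nonneg
      by (simp add: abs_mult continuous_on_power)
  qed
  then show ?thesis using bounded_variation_jump_fun by blast
qed

section \<open>Dunkl operators and generating functions\<close>

lemma dunkl_gamma_pos: "\<nu> > -1 \<Longrightarrow> dunkl_gamma \<nu> n > 0"
  by (auto simp: dunkl_gamma_def intro!: mult_pos_pos pochhammer_pos)

lemma smult_sum_right: "smult c (\<Sum>i\<in>S. F i) = (\<Sum>i\<in>S. smult c (F i))"
  by (induction S rule: infinite_finite_induct) (simp_all add: smult_add_right)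

lemma dunkl_op_add: "dunkl_op \<nu> (p + q) = dunkl_op \<nu> p + dunkl_op \<nu> q"
proof -
  have "(p + q - pcompose (p + q) [:0, -1:]) div [:0, 1:] =
      (p - pcompose p [:0, -1:]) div [:0, 1:] + (q - pcompose q [:0, -1:]) div [:0, 1:]"
    by (simp add: pcompose_add add_diff_add poly_div_add_left)
  then show ?thesis
    by (simp add: dunkl_op_def pderiv_add smult_add_right)
qed

lemma dunkl_op_smult: "dunkl_op \<nu> (smult c p) = smult c (dunkl_op \<nu> p)"
proof -
  have "(smult c p - pcompose (smult c p) [:0, -1:]) div [:0, 1:] =
      smult c ((p - pcompose p [:0, -1:]) div [:0, 1:])"
    by (simp only: pcompose_smult smult_diff_right[symmetric] div_smult_left)
  then show ?thesis
    by (simp add: dunkl_op_def pderiv_smult smult_add_right mult.commute)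
qed

lemma dunkl_op_0 [simp]: "dunkl_op \<nu> 0 = 0"
  by (simp add: dunkl_op_def)

lemma dunkl_op_sum: "dunkl_op \<nu> (\<Sum>i\<in>S. F i) = (\<Sum>i\<in>S. dunkl_op \<nu> (F i))"
  by (induction S rule: infinite_finite_induct) (simp_all add: dunkl_op_add)

lemma dunkl_op_monom_0 [simp]: "dunkl_op \<nu> (monom c 0) = 0"
  by (simp add: dunkl_op_def monom_0 pderiv_pCons)

text \<open>With the normalisation by \<open>dunkl_gamma\<close>, the Dunkl operator lowers the
  index just as differentiation does on \<open>x ^ n / fact n\<close>. The reflection term
  contributes only to odd powers, in agreement with the parity split in
  \<open>dunkl_gamma\<close>.\<close>

lemma dunkl_op_monom_Suc:
  assumes "\<nu> > -1"
  shows "dunkl_op \<nu> (monom (c / dunkl_gamma \<nu> (Suc n)) (Suc n)) = monom (c / dunkl_gamma \<nu> n) n"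
proof -
  let ?d = "c / dunkl_gamma \<nu> (Suc n)"
  have "pcompose (monom ?d (Suc n)) [:0, -1:] = monom (?d * (-1) ^ Suc n) (Suc n)"
  proof (rule poly_ext)
    show "poly (pcompose (monom ?d (Suc n)) [:0, -1:]) x = poly (monom (?d * (-1) ^ Suc n) (Suc n)) x" for x
      using power_minus[of x "Suc n"] by (simp add: poly_pcompose poly_monom del: power_Suc)
  qed
  then have "(monom ?d (Suc n) - pcompose (monom ?d (Suc n)) [:0, -1:])
      = [:0, 1:] * monom (?d * (1 - (-1) ^ Suc n)) n"
    by (simp add: poly_eq_iff coeff_pCons algebra_simps add_divide_distrib split: nat.split)
  moreover have "[:0, 1 :: real:] \<noteq> 0" by simp
  ultimately have div: "(monom ?d (Suc n) - pcompose (monom ?d (Suc n)) [:0, -1:]) div [:0, 1:]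
      = monom (?d * (1 - (-1) ^ Suc n)) n"
    by (simp only: nonzero_mult_div_cancel_left not_False_eq_True)
  have nz: "dunkl_gamma \<nu> k \<noteq> 0" for k
    using dunkl_gamma_pos[OF assms, of k] by simp
  have ratio: "dunkl_gamma \<nu> (Suc n) =
      (real (Suc n) + (2 * \<nu> + 1) / 2 * (1 - (-1) ^ Suc n)) * dunkl_gamma \<nu> n"
  proof (cases "even n")
    case True
    then obtain m where "n = 2 * m" by blast
    then show ?thesis by (simp add: dunkl_gamma_def pochhammer_Suc algebra_simps)
  next
    case False
    then obtain m where "n = 2 * m + 1" using oddE by blast
    then show ?thesis by (simp add: dunkl_gamma_def pochhammer_Suc algebra_simps)
  qed
  have "dunkl_op \<nu> (monom ?d (Suc n)) =
      monom (?d * (real (Suc n) + (2 * \<nu> + 1) / 2 * (1 - (-1) ^ Suc n))) n"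
    unfolding dunkl_op_def div pderiv_monom smult_monom diff_Suc_1 add_monom
    by (rule arg_cong[where f = "\<lambda>c. monom c n"]) (simp only: distrib_left mult_ac)
  also have "?d * (real (Suc n) + (2 * \<nu> + 1) / 2 * (1 - (-1) ^ Suc n)) = c / dunkl_gamma \<nu> n"
    using nz[of n] nz[of "Suc n"] unfolding ratio by (simp add: field_simps)
  finally show ?thesis .
qed

text \<open>This expands E(x h(t)) in normalised monomials, on which the Dunkl operator acts as a
  shift. The proof rests on \<open>fps_const_poly\<close> being multiplicative.\<close>

lemma fps_nth_dunkl_exp_x:
  "fps_nth (dunkl_exp_x \<nu> h) n = (\<Sum>i\<le>n. monom (fps_nth (h ^ i) n / dunkl_gamma \<nu> i) i)"
proof -
  have mult: "fps_const_poly (F * G) = fps_const_poly F * fps_const_poly G" for F G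
    by (rule fps_ext) (simp add: fps_const_poly_def fps_mult_nth monom_sum mult_monom
        flip: monom_0)
  have nth: "fps_nth (fps_const_poly F) k = [:fps_nth F k:]" for F k
    by (simp add: fps_const_poly_def)
  have one: "fps_const_poly 1 = 1"
    by (rule fps_ext) (simp add: fps_const_poly_def)
  have pow: "fps_const_poly h ^ i = fps_const_poly (h ^ i)" for i
    by (induction i) (simp_all add: mult one)
  have "fps_nth (dunkl_exp_x \<nu> h) n =
      (\<Sum>i\<le>n. [:1 / dunkl_gamma \<nu> i:] * ([:0, 1:] ^ i * [:fps_nth (h ^ i) n:]))"
    by (simp add: dunkl_exp_x_def fps_compose_nth power_mult_distrib pow
        nth dunkl_exp_def dunkl_series_def atLeast0AtMost)
  also have "\<dots> = (\<Sum>i\<le>n. monom (fps_nth (h ^ i) n / dunkl_gamma \<nu> i) i)"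
    by (intro sum.cong refl) (simp add: monom_altdef mult.commute)
  finally show ?thesis .
qed

text \<open>The coefficient form of the eigenvalue relation: applying the Dunkl operator
  \<open>k\<close> times in x multiplies E(x h(t)) by \<open>h ^ k\<close>.\<close>

lemma dunkl_op_power_exp_coeff:
  assumes "\<nu> > -1" and "fps_nth h 0 = 0"
  shows "(dunkl_op \<nu> ^^ k) (fps_nth (dunkl_exp_x \<nu> h) n) =
    (\<Sum>i\<le>n. monom (fps_nth (h ^ (i + k)) n / dunkl_gamma \<nu> i) i)"
proof (induction k)
  case 0
  then show ?case by (simp add: fps_nth_dunkl_exp_x)
next
  case (Suc k)
  \<comment> \<open>This allows a zero term \<open>i = Suc n\<close> to be appended; the operator
    kills \<open>i = 0\<close> and shifts the others, so the range is again
    \<open>i \<le> n\<close>.\<close>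
  have van: "fps_nth (h ^ (Suc n + k)) n = 0"
    using startsby_zero_power_prefix[OF assms(2), of "Suc n + k"] by simp
  have "(dunkl_op \<nu> ^^ Suc k) (fps_nth (dunkl_exp_x \<nu> h) n) =
      (\<Sum>i\<le>n. dunkl_op \<nu> (monom (fps_nth (h ^ (i + k)) n / dunkl_gamma \<nu> i) i))"
    by (simp add: Suc dunkl_op_sum)
  also have "\<dots> = (\<Sum>i\<le>Suc n. dunkl_op \<nu> (monom (fps_nth (h ^ (i + k)) n / dunkl_gamma \<nu> i) i))"
    using van by simp
  also have "\<dots> = (\<Sum>i\<le>n. monom (fps_nth (h ^ (i + Suc k)) n / dunkl_gamma \<nu> i) i)"
    by (subst sum.atMost_Suc_shift) (simp add: dunkl_op_monom_Suc[OF assms(1)] del: power_Suc)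
  finally show ?case .
qed

text \<open>Since \<open>h ^ k\<close> has no terms below \<open>t ^ k\<close>, all inner sums may
  run up to the common bound \<open>n\<close>, and the order of summation can be exchanged.\<close>

lemma fps_nth_compose_mult_power:
  fixes W h :: "real fps"
  assumes "fps_nth h 0 = 0"
  shows "fps_nth (fps_compose W h * h ^ i) n = (\<Sum>k\<le>n. fps_nth W k * fps_nth (h ^ (k + i)) n)"
proof -
  have "fps_nth (fps_compose W h * h ^ i) n =
      (\<Sum>j\<le>n. (\<Sum>k\<le>n. fps_nth W k * fps_nth (h ^ k) j) * fps_nth (h ^ i) (n - j))"
    unfolding fps_mult_nth fps_compose_nth atLeast0AtMost
  proof (intro sum.cong refl)
    fix j assume "j \<in> {..n}"
    then have "(\<Sum>k\<le>j. fps_nth W k * fps_nth (h ^ k) j) = (\<Sum>k\<le>n. fps_nth W k * fps_nth (h ^ k) j)"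
      using startsby_zero_power_prefix[OF assms]
      by (intro sum.mono_neutral_left) auto
    then show "(\<Sum>k\<le>j. fps_nth W k * fps_nth (h ^ k) j) * fps_nth (h ^ i) (n - j) =
        (\<Sum>k\<le>n. fps_nth W k * fps_nth (h ^ k) j) * fps_nth (h ^ i) (n - j)"
      by simp
  qed
  also have "\<dots> = (\<Sum>k\<le>n. fps_nth W k * (\<Sum>j\<le>n. fps_nth (h ^ k) j * fps_nth (h ^ i) (n - j)))"
    unfolding sum_distrib_left sum_distrib_right by (subst sum.swap) (simp add: mult.assoc)
  also have "\<dots> = (\<Sum>k\<le>n. fps_nth W k * fps_nth (h ^ (k + i)) n)"
    by (simp add: power_add fps_mult_nth atLeast0AtMost)
  finally show ?thesis .
qed

text \<open>By the eigenvalue relation, multiplication by W(h(t)) acts on E(x h(t)) as the operator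
  obtained by substituting the Dunkl operator into W.\<close>

lemma fps_nth_const_poly_mult_exp_x:
  assumes "\<nu> > -1" and h0: "fps_nth h 0 = 0"
  shows "fps_nth (fps_const_poly (fps_compose W h) * dunkl_exp_x \<nu> h) n =
    (\<Sum>k\<le>n. smult (fps_nth W k) ((dunkl_op \<nu> ^^ k) (fps_nth (dunkl_exp_x \<nu> h) n)))"
proof -
  have ext: "fps_nth (dunkl_exp_x \<nu> h) (n - j) =
      (\<Sum>i\<le>n. monom (fps_nth (h ^ i) (n - j) / dunkl_gamma \<nu> i) i)" for j
    unfolding fps_nth_dunkl_exp_x using startsby_zero_power_prefix[OF h0]
    by (intro sum.mono_neutral_left) auto
  have "fps_nth (fps_const_poly (fps_compose W h) * dunkl_exp_x \<nu> h) n =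
      (\<Sum>j\<le>n. \<Sum>i\<le>n. monom (fps_nth (fps_compose W h) j * fps_nth (h ^ i) (n - j) / dunkl_gamma \<nu> i) i)"
    by (simp add: fps_mult_nth fps_const_poly_def atLeast0AtMost ext smult_sum_right smult_monom)
  also have "\<dots> = (\<Sum>i\<le>n. monom (fps_nth (fps_compose W h * h ^ i) n / dunkl_gamma \<nu> i) i)"
    by (subst sum.swap) (simp add: fps_mult_nth atLeast0AtMost sum_divide_distrib monom_sum)
  also have "\<dots> = (\<Sum>i\<le>n. \<Sum>k\<le>n. smult (fps_nth W k) (monom (fps_nth (h ^ (i + k)) n / dunkl_gamma \<nu> i) i))"
    by (simp add: fps_nth_compose_mult_power[OF h0] sum_divide_distrib monom_sum smult_monom add.commute)
  also have "\<dots> = (\<Sum>k\<le>n. smult (fps_nth W k) ((dunkl_op \<nu> ^^ k) (fps_nth (dunkl_exp_x \<nu> h) n)))"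
    by (subst sum.swap) (simp add: dunkl_op_power_exp_coeff[OF assms] smult_sum_right)
  finally show ?thesis .
qed

lemma dunkl_op_power_smult: "(dunkl_op \<nu> ^^ k) (smult c p) = smult c ((dunkl_op \<nu> ^^ k) p)"
  by (induction k) (simp_all add: dunkl_op_smult)

text \<open>The prefactor 1 / g(h(t)) is W(h(t)) for W = 1 / g, so comparing coefficients of
  \<open>t ^ n\<close> turns the generating function into an explicit operator formula for
  \<open>s n\<close>.\<close>

lemma sheffer_dunkl_iff:
  assumes "\<nu> > -1" and "fps_nth g 0 \<noteq> 0" and g: "dunkl_series \<nu> \<omega> = inverse g"
  shows "sheffer_dunkl \<nu> g f s \<longleftrightarrow> (\<forall>n x. poly (s n) x =
    (\<Sum>k\<le>n. \<omega> k / dunkl_gamma \<nu> k * poly ((dunkl_op \<nu> ^^ k) (associated_dunkl_poly \<nu> f n)) x))"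
proof -
  define h where "h = fps_inv f"
  \<comment> \<open>The recursion defining \<open>fps_inv\<close> starts from 0.\<close>
  have h0: "fps_nth h 0 = 0" by (simp add: h_def fps_inv_def)
  have nz: "dunkl_gamma \<nu> k \<noteq> 0" for k
    using dunkl_gamma_pos[OF assms(1), of k] by simp
  have inv: "inverse (fps_compose g h) = fps_compose (dunkl_series \<nu> \<omega>) h"
    using fps_inverse_compose[OF h0 assms(2)] g by simp
  let ?S = "\<lambda>n. \<Sum>k\<le>n. smult (\<omega> k / dunkl_gamma \<nu> k) ((dunkl_op \<nu> ^^ k) (fps_nth (dunkl_exp_x \<nu> h) n))"
  have "sheffer_dunkl \<nu> g f s \<longleftrightarrow> (\<forall>n. ?S n = smult (1 / dunkl_gamma \<nu> n) (s n))"
    unfolding sheffer_dunkl_def h_def[symmetric] inv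
    by (simp add: fps_eq_iff fps_nth_const_poly_mult_exp_x[OF assms(1) h0]) (simp add: dunkl_series_def)
  also have "\<dots> \<longleftrightarrow> (\<forall>n. s n = smult (dunkl_gamma \<nu> n) (?S n))"
  proof -
    have "p = smult (1 / c) q \<longleftrightarrow> q = smult c p" if "c \<noteq> 0" for c :: real and p q
    proof
      assume "p = smult (1 / c) q"
      then show "q = smult c p" using that by simp
    next
      assume "q = smult c p"
      then show "p = smult (1 / c) q" using that by simp
    qed
    from this[OF nz] show ?thesis by (simp only: eq_commute)
  qed
  also have "\<dots> \<longleftrightarrow> (\<forall>n. s n = (\<Sum>k\<le>n. smult (\<omega> k / dunkl_gamma \<nu> k)
      ((dunkl_op \<nu> ^^ k) (associated_dunkl_poly \<nu> f n))))"
    by (simp add: associated_dunkl_poly_def dunkl_op_power_smult smult_sum_right h_def mult.commute)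
  also have "\<dots> \<longleftrightarrow> (\<forall>n x. poly (s n) x =
    (\<Sum>k\<le>n. \<omega> k / dunkl_gamma \<nu> k * poly ((dunkl_op \<nu> ^^ k) (associated_dunkl_poly \<nu> f n)) x))"
    unfolding poly_eq_poly_eq_iff[symmetric] fun_eq_iff poly_sum poly_smult by (rule refl)
  finally show ?thesis .
qed

text \<open>For \<open>k > n\<close> the coefficients of \<open>h ^ (i + k)\<close> at
  \<open>t ^ n\<close> vanish, where \<open>h = fps_inv f\<close>. The translation is thus a
  polynomial in \<open>t\<close>, and its integral is a finite combination of moments.\<close>

lemma dunkl_translation_associated:
  assumes "\<nu> > -1"
  shows "dunkl_translation \<nu> t (associated_dunkl_poly \<nu> f n) x =
    (\<Sum>k\<le>n. poly ((dunkl_op \<nu> ^^ k) (associated_dunkl_poly \<nu> f n)) x / dunkl_gamma \<nu> k * t ^ k)"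
proof -
  have "(dunkl_op \<nu> ^^ k) (associated_dunkl_poly \<nu> f n) = 0" if "k > n" for k
  proof -
    have h0: "fps_nth (fps_inv f) 0 = 0" by (simp add: fps_inv_def)
    show ?thesis
      using startsby_zero_power_prefix[OF h0] that
      by (simp add: associated_dunkl_poly_def dunkl_op_power_smult dunkl_op_power_exp_coeff[OF assms h0])
  qed
  then show ?thesis
    unfolding dunkl_translation_def by (subst suminf_finite[of "{..n}"]) auto
qed

section \<open>The Stieltjes representation\<close>

lemma has_stieltjes_integral_translation:
  assumes "\<nu> > -1" and "\<And>k. has_stieltjes_integral (\<lambda>x. x ^ k) \<beta> (\<omega> k)"
  shows "has_stieltjes_integral (\<lambda>t. dunkl_translation \<nu> t (associated_dunkl_poly \<nu> f n) x) \<beta>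
    (\<Sum>k\<le>n. \<omega> k / dunkl_gamma \<nu> k * poly ((dunkl_op \<nu> ^^ k) (associated_dunkl_poly \<nu> f n)) x)"
proof -
  let ?c = "\<lambda>k. poly ((dunkl_op \<nu> ^^ k) (associated_dunkl_poly \<nu> f n)) x / dunkl_gamma \<nu> k"
  have "has_stieltjes_integral (\<lambda>t. \<Sum>k\<le>n. ?c k * t ^ k) \<beta> (\<Sum>k\<le>n. ?c k * \<omega> k)"
    by (intro has_stieltjes_integral_sum has_stieltjes_integral_cmult assms) simp
  then show ?thesis
    by (simp add: dunkl_translation_associated[OF assms(1)] mult.commute)
qed

text \<open>The integral of the translation exists and equals the operator formula of
  \<open>sheffer_dunkl_iff\<close>; uniqueness of the integral makes the two conditions on
  \<open>s\<close> the same.\<close>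

lemma stieltjes_representation_iff_sheffer:
  assumes "\<nu> > -1" and "fps_nth g 0 \<noteq> 0" and "dunkl_series \<nu> \<omega> = inverse g"
    and "\<And>k. has_stieltjes_integral (\<lambda>x. x ^ k) \<beta> (\<omega> k)"
  shows "(\<forall>n x. has_stieltjes_integral
      (\<lambda>t. dunkl_translation \<nu> t (associated_dunkl_poly \<nu> f n) x) \<beta> (poly (s n) x)) \<longleftrightarrow>
    sheffer_dunkl \<nu> g f s"
  unfolding sheffer_dunkl_iff[OF assms(1-3)]
  using has_stieltjes_integral_translation[where \<beta> = \<beta> and \<omega> = \<omega>, OF assms(1,4)]
    has_stieltjes_integral_unique
  by metis

lemma dunkl_series_surj:
  assumes "\<nu> > -1"
  shows "dunkl_series \<nu> (\<lambda>n. dunkl_gamma \<nu> n * fps_nth F n) = F"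
proof -
  have "dunkl_gamma \<nu> n \<noteq> 0" for n
    using dunkl_gamma_pos[OF assms, of n] by simp
  then show ?thesis by (simp add: dunkl_series_def fps_eq_iff)
qed

lemma dunkl_series_nth_0 [simp]: "fps_nth (dunkl_series \<nu> c) 0 = c 0"
  by (simp add: dunkl_series_def dunkl_gamma_def)

lemma sheffer_dunkl_iff_stieltjes:
  assumes "\<nu> > -1" and "fps_nth g 0 \<noteq> 0"
  shows "sheffer_dunkl \<nu> g f s \<longleftrightarrow>
    (\<exists>\<beta> \<omega>. bounded_variation_real \<beta> \<and>
       (\<forall>n. has_stieltjes_integral (\<lambda>x. x ^ n) \<beta> (\<omega> n)) \<and> \<omega> 0 \<noteq> 0 \<and>
       dunkl_series \<nu> \<omega> = inverse g \<and>
       (\<forall>n x. has_stieltjes_integral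
          (\<lambda>t. dunkl_translation \<nu> t (associated_dunkl_poly \<nu> f n) x) \<beta> (poly (s n) x)))"
    (is "_ \<longleftrightarrow> ?R")
proof
  assume L: "sheffer_dunkl \<nu> g f s"
  define \<omega> where "\<omega> n = dunkl_gamma \<nu> n * fps_nth (inverse g) n" for n
  have \<omega>: "dunkl_series \<nu> \<omega> = inverse g"
    unfolding \<omega>_def by (rule dunkl_series_surj[OF assms(1)])
  have "\<omega> 0 \<noteq> 0"
    using assms(2) by (simp add: \<omega>_def dunkl_gamma_def)
  moreover obtain \<beta> where \<beta>: "bounded_variation_real \<beta>"
      "\<And>j. has_stieltjes_integral (\<lambda>x. x ^ j) \<beta> (\<omega> j)"
    using ex_bounded_variation_moments by blast
  ultimately show ?R
    using stieltjes_representation_iff_sheffer[OF assms \<omega> \<beta>(2)] L \<omega> by blast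
next
  assume ?R
  then show "sheffer_dunkl \<nu> g f s"
    using stieltjes_representation_iff_sheffer[OF assms] by blast
qed

text \<open>The moments determine g as the reciprocal of their series. Hence g is quantified
  existentially in the first equivalence, while for a prescribed \<open>g\<close> the second one
  ties the moments to \<open>inverse g\<close>.\<close>

theorem theorem3:
  fixes \<nu> :: real
    and a b :: "nat \<Rightarrow> real"
    and f g :: "real fps"
    and s :: "nat \<Rightarrow> real poly"
  assumes "\<nu> > -1"
    and "f = dunkl_series \<nu> a" and "a 0 = 0" and "a 1 \<noteq> 0"
    and "g = dunkl_series \<nu> b" and "b 0 \<noteq> 0"
  shows
    "((\<exists>c. c 0 \<noteq> 0 \<and> sheffer_dunkl \<nu> (dunkl_series \<nu> c) f s) \<longleftrightarrow>
      (\<exists>\<beta> \<omega>. bounded_variation_real \<beta> \<and>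
         (\<forall>n. has_stieltjes_integral (\<lambda>x. x ^ n) \<beta> (\<omega> n)) \<and> \<omega> 0 \<noteq> 0 \<and>
         (\<forall>n x. has_stieltjes_integral
            (\<lambda>t. dunkl_translation \<nu> t (associated_dunkl_poly \<nu> f n) x) \<beta> (poly (s n) x))))
     \<and>
     (sheffer_dunkl \<nu> g f s \<longleftrightarrow>
      (\<exists>\<beta> \<omega>. bounded_variation_real \<beta> \<and>
         (\<forall>n. has_stieltjes_integral (\<lambda>x. x ^ n) \<beta> (\<omega> n)) \<and> \<omega> 0 \<noteq> 0 \<and>
         dunkl_series \<nu> \<omega> = inverse g \<and>
         (\<forall>n x. has_stieltjes_integral
            (\<lambda>t. dunkl_translation \<nu> t (associated_dunkl_poly \<nu> f n) x) \<beta> (poly (s n) x))))"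
proof (intro conjI iffI)
  assume "\<exists>c. c 0 \<noteq> 0 \<and> sheffer_dunkl \<nu> (dunkl_series \<nu> c) f s"
  then obtain c where "c 0 \<noteq> 0" "sheffer_dunkl \<nu> (dunkl_series \<nu> c) f s" by blast
  then show "\<exists>\<beta> \<omega>. bounded_variation_real \<beta> \<and>
      (\<forall>n. has_stieltjes_integral (\<lambda>x. x ^ n) \<beta> (\<omega> n)) \<and> \<omega> 0 \<noteq> 0 \<and>
      (\<forall>n x. has_stieltjes_integral
         (\<lambda>t. dunkl_translation \<nu> t (associated_dunkl_poly \<nu> f n) x) \<beta> (poly (s n) x))"
    using sheffer_dunkl_iff_stieltjes[OF assms(1), of "dunkl_series \<nu> c" f s] by auto
next
  assume "\<exists>\<beta> \<omega>. bounded_variation_real \<beta> \<and>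
      (\<forall>n. has_stieltjes_integral (\<lambda>x. x ^ n) \<beta> (\<omega> n)) \<and> \<omega> 0 \<noteq> 0 \<and>
      (\<forall>n x. has_stieltjes_integral
         (\<lambda>t. dunkl_translation \<nu> t (associated_dunkl_poly \<nu> f n) x) \<beta> (poly (s n) x))"
  then obtain \<beta> \<omega> where \<omega>: "\<And>n. has_stieltjes_integral (\<lambda>x. x ^ n) \<beta> (\<omega> n)" "\<omega> 0 \<noteq> 0"
    and s: "\<And>n x. has_stieltjes_integral
         (\<lambda>t. dunkl_translation \<nu> t (associated_dunkl_poly \<nu> f n) x) \<beta> (poly (s n) x)"
    by blast
  \<comment> \<open>The reciprocal exists because the constant coefficient is
    \<open>\<omega> 0\<close>, as \<open>dunkl_gamma \<nu> 0 = 1\<close>.\<close>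
  define G where "G = inverse (dunkl_series \<nu> \<omega>)"
  define c where "c n = dunkl_gamma \<nu> n * fps_nth G n" for n
  have G0: "fps_nth G 0 \<noteq> 0" and Ginv: "dunkl_series \<nu> \<omega> = inverse G"
    using \<omega>(2) by (simp_all add: G_def)
  have Gc: "dunkl_series \<nu> c = G"
    unfolding c_def by (rule dunkl_series_surj[OF assms(1)])
  have "sheffer_dunkl \<nu> G f s"
    using stieltjes_representation_iff_sheffer[OF assms(1) G0 Ginv \<omega>(1)] s by blast
  moreover have "c 0 \<noteq> 0"
    using G0 dunkl_series_nth_0[of \<nu> c] by (simp add: Gc)
  ultimately show "\<exists>c. c 0 \<noteq> 0 \<and> sheffer_dunkl \<nu> (dunkl_series \<nu> c) f s"
    using Gc by blast
qed (use sheffer_dunkl_iff_stieltjes[OF assms(1), of g f s] assms(5,6) in auto)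

end
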